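(* For any positive integers $p$ and $q$, the unit pseudo-sphere $\mathbb{S}^{p,q}$ is a non-degenerate semi-Riemannian submanifold of $\mathbb{R}^{p,q}$.
   Context: $\mathrm{I}_{p,q}$ is the diagonal matrix with first $p$ diagonal entries $-1$ and remaining $q$ entries $1$; the Minkowski space $\mathbb{R}^{p,q}$ is $\mathbb{R}^{p+q}$ with scalar product $\langle u,v\rangle=u^{\top}\mathrm{I}_{p,q}v$ on each tangent space. The unit pseudo-sphere is $\mathbb{S}^{p,q}=\{(x_1,\dots,x_p,y_1,\dots,y_q)\in\mathbb{R}^{p,q}:-\sum_{j=1}^px_j^2+\sum_{j=1}^qy_j^2=1\}$. A submanifold $X\subseteq\mathbb{R}^{p,q}$ is non-degenerate if for every $x\in X$ the restriction of $\langle\cdot,\cdot\rangle$ to $T_xX$ is non-degenerate, i.e. $\{u\in T_xX:\langle u,v\rangle=0\text{ for all }v\in T_xX\}=\{0\}$. *)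

theory Defs
  imports "HOL-Analysis.Analysis"
begin

text \<open>The spaces \<open>R\<^sup>p\<^sup>,\<^sup>q\<close> are modelled on \<open>real ^ ('p + 'q)\<close> with \<open>p = CARD('p)\<close> and
  \<open>q = CARD('q)\<close>; both are positive because types are nonempty. \<open>Inl\<close> indexes the first \<open>p\<close>
  coordinates, \<open>Inr\<close> the remaining \<open>q\<close>.\<close>

definition I_pq :: "real ^ ('p::finite + 'q::finite) ^ ('p + 'q)" where
  "I_pq = (\<chi> i j. if i = j then (case i of Inl _ \<Rightarrow> - 1 | Inr _ \<Rightarrow> 1) else 0)"

definition mink :: "real ^ ('p::finite + 'q::finite) \<Rightarrow> real ^ ('p + 'q) \<Rightarrow> real" where
  "mink u v = u \<bullet> (I_pq *v v)"

definition pseudo_sphere :: "(real ^ ('p::finite + 'q::finite)) set" where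
  "pseudo_sphere = {z. - (\<Sum>j\<in>UNIV. (z $ Inl j)\<^sup>2) + (\<Sum>j\<in>UNIV. (z $ Inr j)\<^sup>2) = 1}"

text \<open>\<open>Ck_on k f S\<close> expresses that \<open>f\<close> is \<open>k\<close> times continuously differentiable on the open set
  \<open>S\<close>: all iterated directional derivatives up to order \<open>k\<close> exist (in the Frechet sense) and are
  continuous. It is meant for finite-dimensional domains and open \<open>S\<close> only.\<close>

primrec Ck_on :: "nat \<Rightarrow> ('a::euclidean_space \<Rightarrow> 'b::euclidean_space) \<Rightarrow> 'a set \<Rightarrow> bool" where
  "Ck_on 0 f S \<longleftrightarrow> continuous_on S f"
| "Ck_on (Suc k) f S \<longleftrightarrow>
     (\<forall>x\<in>S. f differentiable (at x)) \<and> (\<forall>v. Ck_on k (\<lambda>x. frechet_derivative f (at x) v) S)"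

definition smooth_on :: "'a::euclidean_space set \<Rightarrow> ('a \<Rightarrow> 'b::euclidean_space) \<Rightarrow> bool" where
  "smooth_on S f \<longleftrightarrow> (\<forall>k. Ck_on k f S)"

definition diffeo_between ::
    "'a::euclidean_space set \<Rightarrow> 'a set \<Rightarrow> ('a \<Rightarrow> 'a) \<Rightarrow> ('a \<Rightarrow> 'a) \<Rightarrow> bool" where
  "diffeo_between U V f g \<longleftrightarrow>
     open U \<and> open V \<and> f ` U = V \<and> g ` V = U \<and>
     (\<forall>x\<in>U. g (f x) = x) \<and> (\<forall>y\<in>V. f (g y) = y) \<and> smooth_on U f \<and> smooth_on V g"

text \<open>Embedded submanifolds of a Euclidean space, by slice charts: locally, a diffeomorphism of open
  subsets of the ambient space straightens \<open>X\<close> to a \<open>k\<close>-dimensional linear subspace.\<close>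

definition submanifold :: "nat \<Rightarrow> 'a::euclidean_space set \<Rightarrow> bool" where
  "submanifold k X \<longleftrightarrow>
     (\<forall>x\<in>X. \<exists>U V f g L. x \<in> U \<and> diffeo_between U V f g \<and> subspace L \<and> dim L = k \<and>
        f ` (U \<inter> X) = V \<inter> L)"

text \<open>The tangent space consists of the velocities of smooth curves in \<open>X\<close> through \<open>x\<close>, as vectors of
  the ambient space.\<close>

definition tangent_space :: "'a::euclidean_space set \<Rightarrow> 'a \<Rightarrow> 'a set" where
  "tangent_space X x =
     {v. \<exists>e>0. \<exists>c :: real \<Rightarrow> 'a. smooth_on {-e<..<e} c \<and> c ` {-e<..<e} \<subseteq> X \<and> c 0 = x \<and>
        (c has_vector_derivative v) (at 0)}"

definition nondegenerate_on :: "(real ^ ('p::finite + 'q::finite)) set \<Rightarrow> bool" where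
  "nondegenerate_on T \<longleftrightarrow> {u \<in> T. \<forall>v\<in>T. mink u v = 0} = {0}"

definition nondegenerate_submanifold :: "(real ^ ('p::finite + 'q::finite)) set \<Rightarrow> bool" where
  "nondegenerate_submanifold X \<longleftrightarrow>
     (\<exists>k. submanifold k X) \<and> (\<forall>x\<in>X. nondegenerate_on (tangent_space X x))"

text \<open>The index of the restriction of the scalar product to \<open>T\<close>: the largest dimension of a
  subspace of \<open>T\<close> on which it is negative definite.\<close>

definition index_on :: "(real ^ ('p::finite + 'q::finite)) set \<Rightarrow> nat" where
  "index_on T = Max {dim W |W. subspace W \<and> W \<subseteq> T \<and> (\<forall>w\<in>W - {0}. mink w w < 0)}"

text \<open>A semi-Riemannian submanifold is one on which the ambient scalar product induces a metric
  tensor, that is, a smooth symmetric non-degenerate (0,2)-tensor field of constant index. Smoothness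
  and symmetry are inherited by every restriction of the constant symmetric form \<^const>\<open>mink\<close>, so the
  conditions left are non-degeneracy and constancy of the index.\<close>

definition semi_Riemannian_submanifold :: "(real ^ ('p::finite + 'q::finite)) set \<Rightarrow> bool" where
  "semi_Riemannian_submanifold X \<longleftrightarrow>
     (\<exists>k. submanifold k X) \<and> (\<forall>x\<in>X. nondegenerate_on (tangent_space X x)) \<and>
     (\<exists>m. \<forall>x\<in>X. index_on (tangent_space X x) = m)"

end

theory Submission
  imports Defs
begin

text \<open>Fix \<open>z\<close> on the pseudo-sphere. Translating by \<open>z\<close> and then applying the inversion
  \<open>u \<mapsto> u / \<langle>u, u\<rangle>\<close> (an involution off the null cone) sends the pseudo-sphere into the affine
  hyperplane \<open>\<langle>x, z\<rangle> = 1/2\<close>, because \<open>\<langle>u - z, u - z\<rangle> = 1\<close> means \<open>\<langle>u, u\<rangle> = 2 \<langle>u, z\<rangle>\<close>. This gives a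
  rational slice chart. The tangent space at \<open>z\<close> is the orthogonal complement of \<open>z\<close>: a vector \<open>v\<close>
  in the complement is the velocity at \<open>0\<close> of the conic \<open>s \<mapsto> \<lambda>(s) (z + (s/2) v) - z\<close>, where
  \<open>\<lambda>(s) = 2 / (1 + s\<^sup>2 \<langle>v, v\<rangle> / 4)\<close>. Since \<open>\<langle>z, z\<rangle> = 1 > 0\<close>, the form restricted to this complement is
  non-degenerate, and orthogonal projection along \<open>z\<close> carries the \<open>p\<close>-dimensional negative
  coordinate subspace injectively to a negative definite subspace of it, so the index is \<open>p\<close>
  everywhere.\<close>

section \<open>Smooth maps\<close>

text \<open>On an open set a derivative depends only on the values taken there, so agreement on
  \<open>S\<close> passes to all directional derivatives and the induction goes through.\<close>

lemma Ck_on_cong: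
  assumes "open S" "Ck_on k f S" "\<And>x. x \<in> S \<Longrightarrow> f x = g x"
  shows "Ck_on k g S"
  using assms(2,3)
proof (induction k arbitrary: f g)
  case 0
  then show ?case by (auto cong: continuous_on_cong)
next
  case (Suc k)
  have der: "(g has_derivative frechet_derivative f (at x)) (at x)" if "x \<in> S" for x
  proof (rule has_derivative_transform_within_open[OF _ assms(1) that])
    show "(f has_derivative frechet_derivative f (at x)) (at x)"
      using Suc.prems(1) that by (simp flip: frechet_derivative_works)
  qed (use Suc.prems(2) in auto)
  then have "frechet_derivative f (at x) v = frechet_derivative g (at x) v" if "x \<in> S" for x v
    using frechet_derivative_at that by metis
  moreover have "g differentiable (at x)" if "x \<in> S" for x
    using der[OF that] by (auto simp: differentiable_def)
  ultimately show ?case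
    using Suc.prems(1) Suc.IH[of "\<lambda>x. frechet_derivative f (at x) v"
        "\<lambda>x. frechet_derivative g (at x) v" for v] by simp
qed

text \<open>Uniqueness of the derivative lets an explicit formula \<open>f'\<close> stand in for
  \<open>frechet_derivative\<close>; the closure rules for \<open>Ck_on\<close> below rest on
  this.\<close>

lemma Ck_on_SucI:
  assumes "open S" "\<And>x. x \<in> S \<Longrightarrow> (f has_derivative f' x) (at x)"
    and "\<And>v. Ck_on k (\<lambda>x. f' x v) S"
  shows "Ck_on (Suc k) f S"
proof -
  have "f' x v = frechet_derivative f (at x) v" if "x \<in> S" for x v
    using frechet_derivative_at[OF assms(2)[OF that]] by simp
  then have "Ck_on k (\<lambda>x. frechet_derivative f (at x) v) S" for v
    by (rule Ck_on_cong[OF assms(1) assms(3)])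
  then show ?thesis
    using assms(2) by (auto simp: differentiable_def)
qed

lemma Ck_on_SucD:
  assumes "Ck_on (Suc k) f S"
  shows "Ck_on k f S"
  using assms
proof (induction k arbitrary: f)
  case 0
  then show ?case
    by (auto intro!: continuous_at_imp_continuous_on differentiable_imp_continuous_within)
qed simp

lemma Ck_on_has_derivative:
  assumes "Ck_on (Suc k) f S" "x \<in> S"
  shows "(f has_derivative frechet_derivative f (at x)) (at x)"
  using assms by (simp flip: frechet_derivative_works)

lemma Ck_on_const: "open S \<Longrightarrow> Ck_on k (\<lambda>x. c) S"
proof (induction k arbitrary: c)
  case (Suc k)
  then show ?case
    using Ck_on_SucI[OF Suc.prems has_derivative_const] by blast
qed simp

lemma Ck_on_bounded_linear:
  assumes "open S" "bounded_linear f"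
  shows "Ck_on k f S"
proof (cases k)
  case 0
  then show ?thesis using assms by (simp add: linear_continuous_on)
next
  case (Suc l)
  then show ?thesis
    using Ck_on_SucI[OF assms(1) bounded_linear_imp_has_derivative[OF assms(2)]
        Ck_on_const[OF assms(1)]] by simp
qed

lemma Ck_on_add:
  assumes "open S" "Ck_on k f S" "Ck_on k g S"
  shows "Ck_on k (\<lambda>x. f x + g x) S"
  using assms(2,3)
proof (induction k arbitrary: f g)
  case 0
  then show ?case by (simp add: continuous_on_add)
next
  case (Suc k)
  show ?case
  proof (rule Ck_on_SucI[OF assms(1)])
    show "((\<lambda>x. f x + g x) has_derivative
        (\<lambda>v. frechet_derivative f (at x) v + frechet_derivative g (at x) v)) (at x)" if "x \<in> S" for x
      using that Suc.prems by (intro has_derivative_add Ck_on_has_derivative)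
    show "Ck_on k (\<lambda>x. frechet_derivative f (at x) v + frechet_derivative g (at x) v) S" for v
      using Suc by auto
  qed
qed

text \<open>Induction by the product rule: each summand pairs one map with a derivative of the
  other, so both must vary in the induction. One rule serves scaling, products and
  \<open>mink\<close>.\<close>

lemma Ck_on_bilinear:
  assumes "bounded_bilinear h" "open S" "Ck_on k f S" "Ck_on k g S"
  shows "Ck_on k (\<lambda>x. h (f x) (g x)) S"
  using assms(3,4)
proof (induction k arbitrary: f g)
  case 0
  then show ?case by (simp add: bounded_bilinear.continuous_on[OF assms(1)])
next
  case (Suc k)
  show ?case
  proof (rule Ck_on_SucI[OF assms(2)])
    show "((\<lambda>x. h (f x) (g x)) has_derivative
        (\<lambda>v. h (f x) (frechet_derivative g (at x) v) + h (frechet_derivative f (at x) v) (g x))) (at x)"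
      if "x \<in> S" for x
      using that Suc.prems by (intro bounded_bilinear.FDERIV[OF assms(1)] Ck_on_has_derivative)
    show "Ck_on k (\<lambda>x. h (f x) (frechet_derivative g (at x) v) + h (frechet_derivative f (at x) v) (g x)) S"
      for v
      using Suc.prems
      by (intro Ck_on_add assms(2) Suc.IH Suc.prems[THEN Ck_on_SucD]) simp_all
  qed
qed

text \<open>The derivative of 1/f is built from 1/f itself and f', so the induction keeps
  \<open>f\<close> fixed. The sign is written as a factor \<open>- 1\<close> to make everything a
  product.\<close>

lemma Ck_on_inverse:
  fixes f :: "'a::euclidean_space \<Rightarrow> real"
  assumes "open S" "Ck_on k f S" "\<And>x. x \<in> S \<Longrightarrow> f x \<noteq> 0"
  shows "Ck_on k (\<lambda>x. inverse (f x)) S"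
  using assms(2)
proof (induction k)
  case 0
  then show ?case using assms(3) by (simp add: continuous_on_inverse)
next
  case (Suc k)
  let ?g = "\<lambda>x. inverse (f x)"
  show ?case
  proof (rule Ck_on_SucI[OF assms(1)])
    show "(?g has_derivative (\<lambda>v. - 1 * (?g x * frechet_derivative f (at x) v * ?g x))) (at x)"
      if "x \<in> S" for x
      using Deriv.has_derivative_inverse[OF assms(3)[OF that] Ck_on_has_derivative[OF Suc.prems that]]
      by simp
    show "Ck_on k (\<lambda>x. - 1 * (?g x * frechet_derivative f (at x) v * ?g x)) S" for v
      using Suc.prems
      by (intro Ck_on_bilinear[OF bounded_bilinear_mult] Ck_on_const assms(1)
          Suc.IH[OF Ck_on_SucD[OF Suc.prems]]) simp_all
  qed
qed

lemma smooth_on_const: "open S \<Longrightarrow> smooth_on S (\<lambda>x. c)"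
  by (simp add: smooth_on_def Ck_on_const)

lemma smooth_on_bounded_linear: "open S \<Longrightarrow> bounded_linear f \<Longrightarrow> smooth_on S f"
  by (simp add: smooth_on_def Ck_on_bounded_linear)

lemma smooth_on_ident: "open S \<Longrightarrow> smooth_on S (\<lambda>x. x)"
  by (simp add: smooth_on_bounded_linear)

lemma smooth_on_add:
  "open S \<Longrightarrow> smooth_on S f \<Longrightarrow> smooth_on S g \<Longrightarrow> smooth_on S (\<lambda>x. f x + g x)"
  by (simp add: smooth_on_def Ck_on_add)

lemma smooth_on_bilinear:
  "bounded_bilinear h \<Longrightarrow> open S \<Longrightarrow> smooth_on S f \<Longrightarrow> smooth_on S g \<Longrightarrow> smooth_on S (\<lambda>x. h (f x) (g x))"
  by (simp add: smooth_on_def Ck_on_bilinear)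

lemmas smooth_on_scaleR = smooth_on_bilinear[OF bounded_bilinear_scaleR]
lemmas smooth_on_mult = smooth_on_bilinear[OF bounded_bilinear_mult]

lemma smooth_on_diff_const:
  "open S \<Longrightarrow> smooth_on S f \<Longrightarrow> smooth_on S (\<lambda>x. f x - c)"
  using smooth_on_add[of S f "\<lambda>x. - c"] by (simp add: smooth_on_const)

lemma smooth_on_inverse:
  fixes f :: "'a::euclidean_space \<Rightarrow> real"
  shows "open S \<Longrightarrow> smooth_on S f \<Longrightarrow> (\<And>x. x \<in> S \<Longrightarrow> f x \<noteq> 0) \<Longrightarrow> smooth_on S (\<lambda>x. inverse (f x))"
  by (simp add: smooth_on_def Ck_on_inverse)

section \<open>The Minkowski scalar product\<close>

lemma I_pq_nth: "(I_pq *v v) $ i = (case i of Inl _ \<Rightarrow> - 1 | Inr _ \<Rightarrow> 1) * v $ i"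
  by (simp add: I_pq_def matrix_vector_mult_def if_distrib[of "\<lambda>x. x * _"] cong: if_cong)

lemma mink_eq:
  "mink u v = - (\<Sum>j\<in>UNIV. u $ Inl j * v $ Inl j) + (\<Sum>j\<in>UNIV. u $ Inr j * v $ Inr j)"
  by (simp add: mink_def inner_vec_def I_pq_nth UNIV_Plus_UNIV[symmetric] sum.Plus sum_negf
      del: UNIV_Plus_UNIV)

interpretation mink: bounded_bilinear mink
  unfolding mink_def
  by (intro bounded_bilinear.comp[OF bounded_bilinear_inner bounded_linear_ident]
      matrix_vector_mul_bounded_linear)

lemma mink_commute: "mink u v = mink v u"
  by (simp add: mink_eq mult.commute)

lemma pseudo_sphere_eq: "pseudo_sphere = {z. mink z z = 1}"
  by (simp add: pseudo_sphere_def mink_eq power2_eq_square)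

text \<open>Testing against \<open>I_pq *v u\<close> turns the form into the squared Euclidean norm
  of that vector, and \<open>I_pq\<close> only changes signs of coordinates.\<close>

lemma mink_eq_0_imp:
  assumes "\<And>v. mink v u = 0"
  shows "u = 0"
proof -
  have "I_pq *v u = 0"
    using assms[of "I_pq *v u"] by (simp add: mink_def)
  then have "(I_pq *v u) $ i = 0" for i
    by simp
  then have "u $ i = 0" for i
    by (cases i) (force simp: I_pq_nth)+
  then show ?thesis
    by (simp add: vec_eq_iff)
qed

definition mink_perp :: "real ^ ('p::finite + 'q::finite) \<Rightarrow> (real ^ ('p + 'q)) set" where
  "mink_perp z = {v. mink v z = 0}"

lemma subspace_mink_perp: "subspace (mink_perp z)"
  by (simp add: mink_perp_def subspace_def mink.add_left mink.scaleR_left mink.zero_left)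

text \<open>The complement of \<open>z\<close> is the Euclidean hyperplane with normal
  \<open>I_pq *v z\<close>, which is nonzero because the form is non-degenerate.\<close>

lemma dim_mink_perp:
  fixes z :: "real ^ ('p::finite + 'q::finite)"
  assumes "z \<noteq> 0"
  shows "dim (mink_perp z) = CARD('p) + CARD('q) - 1"
proof -
  have "I_pq *v z \<noteq> 0"
    using assms mink_eq_0_imp by (metis mink_def inner_zero_right)
  then have "dim {v. (I_pq *v z) \<bullet> v = 0} = DIM(real ^ ('p + 'q)) - 1"
    by (rule dim_hyperplane)
  moreover have "mink_perp z = {v. (I_pq *v z) \<bullet> v = 0}"
    by (simp add: mink_perp_def mink_def inner_commute)
  ultimately show ?thesis
    by simp
qed

section \<open>Slice charts\<close>

text \<open>Since \<open>inverse 0 = 0\<close>, null vectors are sent to 0.\<close>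

definition mink_inversion :: "real ^ ('p::finite + 'q::finite) \<Rightarrow> real ^ ('p + 'q)" where
  "mink_inversion u = inverse (mink u u) *\<^sub>R u"

lemma mink_mink_inversion: "mink (mink_inversion u) (mink_inversion u) = inverse (mink u u)"
  by (cases "mink u u = 0") (simp_all add: mink_inversion_def mink.scaleR_left
      mink.scaleR_right mink.zero_left)

lemma mink_inversion_involution:
  "mink u u \<noteq> 0 \<Longrightarrow> mink_inversion (mink_inversion u) = u"
  unfolding mink_inversion_def[of "mink_inversion u"] mink_mink_inversion
  by (simp add: mink_inversion_def)

lemma open_mink_translate: "open {y. mink (y + a) (y + a) \<noteq> 0}"
  by (intro open_Collect_neq mink.continuous_on continuous_intros)

lemma smooth_on_mink_inversion:
  "smooth_on {y. mink (y + a) (y + a) \<noteq> 0} (\<lambda>y. mink_inversion (y + a) - b)"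
  unfolding mink_inversion_def
  by (intro smooth_on_diff_const smooth_on_scaleR smooth_on_inverse
      smooth_on_bilinear[OF mink.bounded_bilinear_axioms] smooth_on_add smooth_on_ident
      smooth_on_const open_mink_translate) auto

text \<open>Exchanging \<open>a\<close> and \<open>b\<close> exchanges the map with its inverse, so
  each property is proved once for arbitrary \<open>a\<close> and \<open>b\<close> and used in both
  directions.\<close>

lemma diffeo_between_mink_inversion:
  fixes a b :: "real ^ ('a::finite + 'b::finite)"
  shows "diffeo_between {y. mink (y + a) (y + a) \<noteq> 0} {y. mink (y + b) (y + b) \<noteq> 0}
     (\<lambda>y. mink_inversion (y + a) - b) (\<lambda>y. mink_inversion (y + b) - a)"
proof -
  define U where "U a = {y. mink (y + a) (y + a) \<noteq> 0}" for a :: "real ^ ('a + 'b)"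
  define f where "f a b y = mink_inversion (y + a) - b" for a b y :: "real ^ ('a + 'b)"
  have maps: "f a b y \<in> U b" and inv: "f b a (f a b y) = y" if "y \<in> U a" for a b y
    using that by (simp_all add: U_def f_def mink_mink_inversion mink_inversion_involution)
  have image: "f a b ` U a = U b" for a b
    by (rule bij_betw_imp_surj_on[OF bij_betw_byWitness[where f' = "f b a"]])
      (use maps inv in blast)+
  have "open (U a)" and "smooth_on (U a) (f a b)" for a b
    unfolding U_def f_def by (fact open_mink_translate smooth_on_mink_inversion)+
  then have "diffeo_between (U a) (U b) (f a b) (f b a)"
    unfolding diffeo_between_def using image inv by blast
  then show ?thesis
    by (simp only: U_def f_def[abs_def])
qed

lemma submanifold_pseudo_sphere:
  "submanifold (CARD('p) + CARD('q) - 1) (pseudo_sphere :: (real ^ ('p::finite + 'q::finite)) set)"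
  unfolding submanifold_def
proof
  fix z :: "real ^ ('p + 'q)"
  assume "z \<in> pseudo_sphere"
  then have z: "mink z z = 1"
    by (simp add: pseudo_sphere_eq)
  \<comment> \<open>As \<open>mink z z = 1\<close>, the point z/2 lies on the hyperplane where
    \<open>mink x z = 1/2\<close>; subtracting it moves this hyperplane onto the linear subspace
    \<open>mink_perp z\<close>.\<close>
  define b where "b = (1/2) *\<^sub>R z"
  define U where "U = {y. mink (y + z) (y + z) \<noteq> 0}"
  define V where "V = {y. mink (y + b) (y + b) \<noteq> 0}"
  define f where "f y = mink_inversion (y + z) - b" for y
  define g where "g y = mink_inversion (y + b) - z" for y
  have d: "diffeo_between U V f g"
    unfolding U_def V_def f_def g_def by (rule diffeo_between_mink_inversion)
  have "mink y y = 1 \<longleftrightarrow> mink (f y) z = 0" if "y \<in> U" for y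
  proof -
    \<comment> \<open>\<open>n\<close> stays opaque while denominators are cleared; its expansion is
      substituted only afterwards.\<close>
    define n where "n = mink (y + z) (y + z)"
    have n: "n \<noteq> 0" "n = mink y y + 2 * mink y z + 1"
      using that z by (auto simp: U_def n_def mink.add_left mink.add_right mink_commute)
    have "mink (f y) z = inverse n * (mink y z + 1) - 1 / 2"
      by (simp add: f_def b_def mink_inversion_def mink.diff_left mink.scaleR_left
          mink.add_left[of y z z] z flip: n_def)
    also have "\<dots> = (1 - mink y y) / (2 * n)"
      using n(1) by (simp add: field_simps) (simp add: n(2))
    finally show ?thesis
      using n(1) by auto
  qed
  then have "f ` (U \<inter> pseudo_sphere) = f ` U \<inter> mink_perp z"
    by (auto simp: pseudo_sphere_eq mink_perp_def)
  also have "f ` U = V"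
    using d by (simp add: diffeo_between_def)
  finally have "f ` (U \<inter> pseudo_sphere) = V \<inter> mink_perp z" .
  moreover have "z \<in> U"
    using z by (simp add: U_def mink.add_left mink.add_right)
  moreover have "dim (mink_perp z) = CARD('p) + CARD('q) - 1"
    using z by (intro dim_mink_perp) (auto simp: mink.zero_left)
  ultimately show "\<exists>U V f g L. z \<in> U \<and> diffeo_between U V f g \<and> subspace L \<and>
      dim L = CARD('p) + CARD('q) - 1 \<and> f ` (U \<inter> pseudo_sphere) = V \<inter> L"
    using d subspace_mink_perp by blast
qed

section \<open>Tangent spaces\<close>

text \<open>Differentiating the constant function \<open>mink (c s) (c s) = 1\<close> at 0 gives
  twice \<open>mink v z\<close>.\<close>

lemma tangent_space_pseudo_sphere_subset:
  "tangent_space pseudo_sphere z \<subseteq> mink_perp z"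
proof
  fix v
  assume "v \<in> tangent_space pseudo_sphere z"
  then obtain e c where "e > 0" and c: "c ` {-e<..<e} \<subseteq> pseudo_sphere" "c 0 = z"
    and "(c has_vector_derivative v) (at 0)"
    by (auto simp: tangent_space_def)
  then have d: "((\<lambda>s. mink (c s) (c s)) has_vector_derivative (mink (c 0) v + mink v (c 0))) (at 0)"
    using mink.has_vector_derivative by blast
  have "((\<lambda>s. 1) has_vector_derivative (mink (c 0) v + mink v (c 0))) (at (0::real))"
    by (rule has_vector_derivative_transform_within_open[OF d, of "{-e<..<e}"])
      (use \<open>e > 0\<close> c(1) in \<open>auto simp: pseudo_sphere_eq image_subset_iff\<close>)
  then have "mink (c 0) v + mink v (c 0) = 0"
    using vector_derivative_unique_at has_vector_derivative_const by blast
  then show "v \<in> mink_perp z"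
    by (simp add: mink_perp_def c(2) mink_commute)
qed

lemma mink_perp_subset_tangent_space:
  assumes "z \<in> pseudo_sphere"
  shows "mink_perp z \<subseteq> tangent_space pseudo_sphere z"
proof
  fix v
  assume "v \<in> mink_perp z"
  then have v: "mink v z = 0" "mink z v = 0"
    by (auto simp: mink_perp_def mink_commute)
  have z: "mink z z = 1"
    using assms by (simp add: pseudo_sphere_eq)
  define n where "n = mink v v / 4"
  \<comment> \<open>Since \<open>e \<le> 1\<close>, \<open>\<bar>s\<bar> < e\<close> gives
    \<open>\<bar>n * (s * s)\<bar> \<le> \<bar>n\<bar> * e < 1\<close>, which keeps the denominator
    of \<open>c\<close> away from 0.\<close>
  define e where "e = 1 / (1 + \<bar>n\<bar>)"
  \<comment> \<open>Stereographic projection from -z: the line through -z with direction z + (s/2) v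
    meets the pseudo-sphere again at \<open>c s\<close>. The formula covers every sign of
    \<open>mink v v\<close>.\<close>
  define c where "c s = (2 * inverse (1 + n * (s * s))) *\<^sub>R (z + s *\<^sub>R ((1/2) *\<^sub>R v)) - z" for s
  have "e > 0"
    by (simp add: e_def add_pos_nonneg)
  have "e \<le> 1"
    by (simp add: e_def)
  have nz: "1 + n * (s * s) \<noteq> 0" if "s \<in> {-e<..<e}" for s
  proof -
    have s: "\<bar>s\<bar> < e"
      using that by auto
    have "\<bar>n * (s * s)\<bar> \<le> \<bar>n\<bar> * (\<bar>s\<bar> * 1)"
      unfolding abs_mult using s \<open>e \<le> 1\<close> by (intro mult_left_mono) auto
    also have "\<dots> \<le> \<bar>n\<bar> * e"
      using s by (simp add: mult_left_mono)
    also have "\<dots> < 1"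
      by (simp add: e_def field_simps)
    finally show ?thesis
      by linarith
  qed
  have "smooth_on {-e<..<e} c"
    unfolding c_def
    by (intro smooth_on_diff_const smooth_on_scaleR smooth_on_inverse smooth_on_add smooth_on_ident
        smooth_on_const smooth_on_mult nz) auto
  moreover have "c s \<in> pseudo_sphere" if "s \<in> {-e<..<e}" for s
  proof -
    define l where "l = 2 * inverse (1 + n * (s * s))"
    have "mink (c s) (c s) = l * (l * (1 + n * (s * s))) - 2 * l + 1"
      unfolding c_def l_def[symmetric]
      by (simp add: mink.add_left mink.add_right mink.diff_left mink.diff_right mink.scaleR_left
          mink.scaleR_right v z n_def algebra_simps)
    also have "l * (1 + n * (s * s)) = 2"
      using nz[OF that] by (simp add: l_def)
    finally show ?thesis
      by (simp add: pseudo_sphere_eq)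
  qed
  moreover have "c 0 = z"
    by (simp add: c_def scaleR_2)
  \<comment> \<open>At \<open>s = 0\<close> the scalar factor equals 2 and has derivative 0, so the
    velocity is 2 (v/2) = v.\<close>
  moreover have "(c has_vector_derivative v) (at 0)"
    unfolding c_def has_vector_derivative_def
    by (auto intro!: derivative_eq_intros)
  ultimately show "v \<in> tangent_space pseudo_sphere z"
    unfolding tangent_space_def using \<open>e > 0\<close> by blast
qed

lemma tangent_space_pseudo_sphere:
  "z \<in> pseudo_sphere \<Longrightarrow> tangent_space pseudo_sphere z = mink_perp z"
  using tangent_space_pseudo_sphere_subset mink_perp_subset_tangent_space by blast

lemma mink_perp_proj:
  assumes "mink z z = 1"
  shows "w - mink w z *\<^sub>R z \<in> mink_perp z"
  using assms by (simp add: mink_perp_def mink.diff_left mink.scaleR_left)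

text \<open>Every \<open>w\<close> is a vector of \<open>mink_perp z\<close> plus a multiple of
  \<open>z\<close>. A vector \<open>u\<close> of the radical is orthogonal to both parts, hence to
  the whole space.\<close>

lemma nondegenerate_on_mink_perp:
  assumes "mink z z = 1"
  shows "nondegenerate_on (mink_perp z)"
proof -
  have "u = 0" if "u \<in> mink_perp z" "\<forall>v\<in>mink_perp z. mink u v = 0" for u
  proof (rule mink_eq_0_imp)
    fix w
    have "mink z u = 0"
      using that(1) by (simp add: mink_perp_def mink_commute)
    moreover have "mink (w - mink w z *\<^sub>R z) u = 0"
      using that(2) mink_perp_proj[OF assms] mink_commute by metis
    ultimately show "mink w u = 0"
      by (simp add: mink.diff_left mink.scaleR_left)
  qed
  then show ?thesis
    by (auto simp: nondegenerate_on_def mink_perp_def mink.zero_left)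
qed

section \<open>The index\<close>

text \<open>Projection to the first p coordinates is injective on \<open>W\<close>: on vectors in
  its kernel the form is nonnegative.\<close>

lemma dim_le_if_mink_negative:
  fixes W :: "(real ^ ('p::finite + 'q::finite)) set"
  assumes "subspace W" "\<forall>w\<in>W - {0}. mink w w < 0"
  shows "dim W \<le> CARD('p)"
proof -
  define P :: "real ^ ('p + 'q) \<Rightarrow> real ^ 'p" where "P w = (\<chi> j. w $ Inl j)" for w
  have lin: "linear P"
    by (rule linearI) (simp_all add: P_def vec_eq_iff)
  have "w = 0" if "w \<in> W" "P w = 0" for w
  proof (rule ccontr)
    assume "w \<noteq> 0"
    moreover have "w $ Inl j = 0" for j
      using that(2) by (simp add: P_def vec_eq_iff)
    then have "mink w w \<ge> 0"
      by (simp add: mink_eq sum_nonneg)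
    ultimately show False
      using assms(2) that(1) by force
  qed
  then have "inj_on P W"
    using linear_inj_on_iff_eq_0[OF lin assms(1)] by blast
  then have "dim W = dim (P ` W)"
    using dim_image_eq[OF lin] assms(1) by (simp add: span_eq_iff[THEN iffD2])
  also have "\<dots> \<le> CARD('p)"
    using dim_subset_UNIV[of "P ` W"] by simp
  finally show ?thesis .
qed

text \<open>Removing the component along \<open>z\<close> only lowers the form:
  \<open>mink (F x) (F x)\<close> is the negative quantity \<open>- (x \<bullet> x)\<close> minus a
  square. This makes the range of \<open>F\<close> negative definite and \<open>F\<close>
  injective.\<close>

lemma ex_mink_negative_subspace:
  fixes z :: "real ^ ('p::finite + 'q::finite)"
  assumes "mink z z = 1"
  shows "\<exists>W. subspace W \<and> W \<subseteq> mink_perp z \<and> (\<forall>w\<in>W - {0}. mink w w < 0) \<and> dim W = CARD('p)"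
proof -
  define E :: "real ^ 'p \<Rightarrow> real ^ ('p + 'q)"
    where "E x = (\<chi> i. case i of Inl j \<Rightarrow> x $ j | Inr _ \<Rightarrow> 0)" for x
  define F where "F x = E x - mink (E x) z *\<^sub>R z" for x
  have linE: "linear E"
    by (rule linearI) (auto simp: E_def vec_eq_iff split: sum.splits)
  have linF: "linear F"
    by (rule linearI) (simp_all add: F_def linear_add[OF linE] linear_scale[OF linE] mink.add_left
        mink.scaleR_left algebra_simps)
  have FF: "mink (F x) (F x) < 0" if "x \<noteq> 0" for x
  proof -
    have "mink (E x) (E x) = - (x \<bullet> x)"
      by (simp add: mink_eq E_def inner_vec_def)
    then have "mink (F x) (F x) = - (x \<bullet> x) - (mink (E x) z)\<^sup>2"
      by (simp add: F_def mink.diff_left mink.diff_right mink.scaleR_left mink.scaleR_right assms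
          mink_commute[of z "E x"] power2_eq_square)
    moreover have "x \<bullet> x > 0"
      using that by simp
    ultimately show ?thesis
      by (smt (verit) zero_le_power2)
  qed
  then have "inj F"
    using linear_injective_0[OF linF] mink.zero_left by (metis less_irrefl)
  then have "dim (range F) = CARD('p)"
    using dim_image_eq[OF linF, of UNIV] by simp
  moreover have "mink w w < 0" if "w \<in> range F - {0}" for w
    using that FF linear_0[OF linF] by (metis DiffE imageE insertI1)
  moreover have "range F \<subseteq> mink_perp z"
    using mink_perp_proj[OF assms] by (auto simp: F_def)
  ultimately show ?thesis
    using linear_subspace_image[OF linF subspace_UNIV] by blast
qed

lemma index_on_mink_perp:
  fixes z :: "real ^ ('p::finite + 'q::finite)"
  assumes "mink z z = 1"
  shows "index_on (mink_perp z) = CARD('p)"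
  unfolding index_on_def
proof (rule Max_eqI)
  let ?D = "{dim W |W. subspace W \<and> W \<subseteq> mink_perp z \<and> (\<forall>w\<in>W - {0}. mink w w < 0)}"
  show le: "d \<le> CARD('p)" if "d \<in> ?D" for d
    using that dim_le_if_mink_negative by blast
  \<comment> \<open>\<open>Max\<close> is informative only on a finite set; the upper bound on the
    dimensions supplies finiteness as well.\<close>
  show "finite ?D"
    by (rule finite_subset[of _ "{..CARD('p)}"]) (use le in blast)+
  show "CARD('p) \<in> ?D"
    using ex_mink_negative_subspace[OF assms] by (smt (verit) mem_Collect_eq)
qed

theorem lemma4p18:
  shows "nondegenerate_submanifold (pseudo_sphere :: (real ^ ('p::finite + 'q::finite)) set) \<and>
         semi_Riemannian_submanifold (pseudo_sphere :: (real ^ ('p + 'q)) set)"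
proof -
  \<comment> \<open>All tangent spaces have the form \<open>mink_perp z\<close>, so the single value
    \<open>CARD('p)\<close> witnesses the constancy of the index.\<close>
  have "nondegenerate_on (tangent_space pseudo_sphere z)"
    and "index_on (tangent_space pseudo_sphere z) = CARD('p)"
    if "z \<in> pseudo_sphere" for z :: "real ^ ('p + 'q)"
    using that nondegenerate_on_mink_perp[of z] index_on_mink_perp[of z]
    unfolding tangent_space_pseudo_sphere[OF that] by (auto simp: pseudo_sphere_eq)
  then show ?thesis
    unfolding nondegenerate_submanifold_def semi_Riemannian_submanifold_def
    using submanifold_pseudo_sphere by blast
qed

end
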